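(* Let $\mathcal{Q},\mathcal{U},\mathcal{Y}$ be nonzero finite dimensional real Hilbert spaces with $\dim\mathcal{Q}=\dim\mathcal{U}=n_q$ and $\dim\mathcal{Y}=n_{\mathrm{obs}}$. Let $A:\mathcal{U}\to\mathcal{Q}$ be an invertible linear map, $B:\mathcal{U}\to\mathcal{Y}$ a linear map, $R:\mathcal{Q}\to\mathcal{Q}$ an invertible linear map, $T:=-I:\mathcal{Q}\to\mathcal{Q}$ (source inversion problem), let $0<\alpha\le1$, and let $\rho=\sqrt{\alpha}$. Let $J:=-BA^{-1}T=BA^{-1}$, and suppose that $R$ is a spectral filtering regularization operator for the inverse problem with parameter-to-observable map $J$ (see context), with associated singular values $d_k$ of $J$ and $r_k$ of $R$, $k=1,\dots,n_q$. Suppose there are constants $\mu,\nu$ such that for all $k=1,\dots,n_q$ $$0<\mu\le d_k^2+\alpha r_k^2\qquad\text{and}\qquad d_kr_k\le\nu<\infty .$$ Let $Q_R$ and $Q_J$ be as defined in the context. Then, with $$\delta=\frac12\left(1+\nu^2\right)^{-1},\qquad \beta=\left(1+\mu\right)^{-1/2},$$ one has $$0<\delta\le\tfrac12\lambda_{\min}(Q_R+Q_J)\qquad\text{and}\qquad\lambda_{\max}(Q_RQ_J)^{1/2}\le\beta<1 .$$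
   Context: Stars denote Hilbert space adjoints and $I$ the identity; $\lambda_{\min},\lambda_{\max}$ denote smallest and largest eigenvalues of operators with real eigenvalues. Spectral filtering regularization: $R$ is a spectral filtering regularization operator for a linear inverse problem with parameter-to-observable map $J:\mathcal{Q}\to\mathcal{Y}$ if $R$ and $J$ share a common basis of right singular vectors, i.e. there exist unitary (inner product preserving, bijective) operators $U:\mathbb{R}^{n_{\mathrm{obs}}}\to\mathcal{Y}$, $V:\mathbb{R}^{n_q}\to\mathcal{Q}$, $\Phi:\mathbb{R}^{n_q}\to\mathcal{Q}$ and nonnegative diagonal operators $\Sigma_J=\operatorname{diag}(d_k):\mathbb{R}^{n_q}\to\mathbb{R}^{n_{\mathrm{obs}}}$ and $\Sigma_R=\operatorname{diag}(r_k):\mathbb{R}^{n_q}\to\mathbb{R}^{n_q}$ (a rectangular diagonal operator has $k$th diagonal entry as indicated and zeros elsewhere) such that $$J=U\Sigma_J\Phi^*,\qquad R=V\Sigma_R\Phi^* .$$ The $d_k$ are ordered so that $d_k\ge d_{k+1}$ (this fixes a, possibly non-monotone, order for the $r_k$); if $n_{\mathrm{obs}}<n_q$, set $d_k:=0$ for $k=n_{\mathrm{obs}}+1,\dots,n_q$. Damped projectors: $$Q_R:=T\left(\tfrac{\alpha}{\rho}R^*R+T^*T\right)^{-1}T^*,\qquad Q_J:=A\left(\tfrac1\rho B^*B+A^*A\right)^{-1}A^* .$$ Both are self-adjoint positive semidefinite operators on $\mathcal{Q}$, so $Q_RQ_J$ has real nonnegative eigenvalues. *)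

theory Defs
  imports "HOL-Analysis.Analysis" "Jordan_Normal_Form.Matrix"
begin

(* Keep the infix dot for the inner product of euclidean_space types. *)
no_notation scalar_prod (infix \<open>\<bullet>\<close> 70)

(* Finite-dimensional real Hilbert spaces are types of class euclidean_space; R^n is
   carrier_vec n with scalar_prod, so that n may be given by DIM('a). *)

definition unitary_from_vec :: "nat \<Rightarrow> (real Matrix.vec \<Rightarrow> 'a::euclidean_space) \<Rightarrow> bool" where
  "unitary_from_vec n U \<longleftrightarrow>
     (\<forall>x\<in>carrier_vec n. \<forall>y\<in>carrier_vec n. U (x + y) = U x + U y) \<and>
     (\<forall>c. \<forall>x\<in>carrier_vec n. U (c \<cdot>\<^sub>v x) = c *\<^sub>R U x) \<and>
     (\<forall>x\<in>carrier_vec n. \<forall>y\<in>carrier_vec n. U x \<bullet> U y = scalar_prod x y) \<and>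
     bij_betw U (carrier_vec n) UNIV"

definition adjoint_from_vec ::
    "nat \<Rightarrow> (real Matrix.vec \<Rightarrow> 'a::euclidean_space) \<Rightarrow> 'a \<Rightarrow> real Matrix.vec" where
  "adjoint_from_vec n F y =
     (THE z. z \<in> carrier_vec n \<and> (\<forall>x\<in>carrier_vec n. F x \<bullet> y = scalar_prod x z))"

(* Diagonal entries are numbered 1, 2, ..., whereas matrix positions start at 0. *)
definition rect_diag :: "nat \<Rightarrow> nat \<Rightarrow> (nat \<Rightarrow> real) \<Rightarrow> real mat" where
  "rect_diag nr nc d = Matrix.mat nr nc (\<lambda>(i, j). if i = j then d (Suc i) else 0)"

(* R is a spectral filtering regularization operator for J, with associated singular values
   d k of J and r k of R, where k ranges over 1..DIM('q). *)
definition spectral_filtering ::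
    "('q::euclidean_space \<Rightarrow> 'q) \<Rightarrow> ('q \<Rightarrow> 'y::euclidean_space) \<Rightarrow>
     (nat \<Rightarrow> real) \<Rightarrow> (nat \<Rightarrow> real) \<Rightarrow> bool" where
  "spectral_filtering R J d r \<longleftrightarrow>
     (\<forall>k\<in>{1..DIM('q)}. 0 \<le> d k \<and> 0 \<le> r k) \<and>
     (\<forall>k\<in>{1..<DIM('q)}. d k \<ge> d (Suc k)) \<and>
     (\<forall>k\<in>{1..DIM('q)}. DIM('y) < k \<longrightarrow> d k = 0) \<and>
     (\<exists>U V \<Phi>.
        unitary_from_vec DIM('y) U \<and> unitary_from_vec DIM('q) V \<and> unitary_from_vec DIM('q) \<Phi> \<and>
        (\<forall>q. J q = U (rect_diag DIM('y) DIM('q) d *\<^sub>v adjoint_from_vec DIM('q) \<Phi> q)) \<and>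
        (\<forall>q. R q = V (rect_diag DIM('q) DIM('q) r *\<^sub>v adjoint_from_vec DIM('q) \<Phi> q)))"

(* The damped projector  X (c S^* S + X^* X)^{-1} X^*. The notation inv belongs to groups
   here (HOL-Algebra), so function inverses are written inv_into UNIV. *)
definition damped_projector ::
    "real \<Rightarrow> ('a::euclidean_space \<Rightarrow> 'q::euclidean_space) \<Rightarrow> ('a \<Rightarrow> 'z::euclidean_space) \<Rightarrow> 'q \<Rightarrow> 'q" where
  "damped_projector c X S =
     X \<circ> inv_into UNIV (\<lambda>v. c *\<^sub>R adjoint S (S v) + adjoint X (X v)) \<circ> adjoint X"

definition Q_R ::
    "real \<Rightarrow> real \<Rightarrow> ('q::euclidean_space \<Rightarrow> 'q) \<Rightarrow> ('q \<Rightarrow> 'q) \<Rightarrow> 'q \<Rightarrow> 'q" where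
  "Q_R \<alpha> \<rho> R T = damped_projector (\<alpha> / \<rho>) T R"

definition Q_J ::
    "real \<Rightarrow> ('u::euclidean_space \<Rightarrow> 'q::euclidean_space) \<Rightarrow> ('u \<Rightarrow> 'y::euclidean_space) \<Rightarrow> 'q \<Rightarrow> 'q" where
  "Q_J \<rho> A B = damped_projector (1 / \<rho>) A B"

definition eigenvalues :: "('a::real_vector \<Rightarrow> 'a) \<Rightarrow> real set" where
  "eigenvalues F = {c. \<exists>v. v \<noteq> 0 \<and> F v = c *\<^sub>R v}"

(* Meaningful for linear operators, on a nonzero finite-dimensional space, all of whose
   eigenvalues are real. *)
definition lambda_min :: "('a::euclidean_space \<Rightarrow> 'a) \<Rightarrow> real" where
  "lambda_min F = Min (eigenvalues F)"

definition lambda_max :: "('a::euclidean_space \<Rightarrow> 'a) \<Rightarrow> real" where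
  "lambda_max F = Max (eigenvalues F)"

lemma adjoint_from_vec_eqI:
  assumes z: "z \<in> carrier_vec n" and eq: "\<And>x. x \<in> carrier_vec n \<Longrightarrow> F x \<bullet> y = scalar_prod x z"
  shows "adjoint_from_vec n F y = z"
  unfolding adjoint_from_vec_def
proof (rule the_equality)
  fix w assume w: "w \<in> carrier_vec n \<and> (\<forall>x\<in>carrier_vec n. F x \<bullet> y = scalar_prod x w)"
  show "w = z"
  proof (rule eq_vecI)
    fix i assume "i < dim_vec z"
    then have i: "i < n" using z by simp
    have "scalar_prod (unit_vec n i) w = scalar_prod (unit_vec n i) z"
      using w eq[of "unit_vec n i"] by simp
    then show "w $ i = z $ i"
      using w z i by simp
  qed (use w z in simp)
qed (use assms in simp)

lemma unitary_adjoint_from_vec: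
  assumes U: "unitary_from_vec n U"
  shows "adjoint_from_vec n U y \<in> carrier_vec n"
    and "x \<in> carrier_vec n \<Longrightarrow> U x \<bullet> y = scalar_prod x (adjoint_from_vec n U y)"
    and "U (adjoint_from_vec n U y) = y"
proof -
  have "bij_betw U (carrier_vec n) UNIV" using U by (simp add: unitary_from_vec_def)
  then obtain z where z: "z \<in> carrier_vec n" "U z = y"
    by (metis UNIV_I bij_betw_imp_surj_on imageE)
  have "\<And>x. x \<in> carrier_vec n \<Longrightarrow> U x \<bullet> y = scalar_prod x z"
    using U z unfolding unitary_from_vec_def by metis
  moreover from z(1) this have "adjoint_from_vec n U y = z" by (rule adjoint_from_vec_eqI)
  ultimately show "adjoint_from_vec n U y \<in> carrier_vec n"
    and "x \<in> carrier_vec n \<Longrightarrow> U x \<bullet> y = scalar_prod x (adjoint_from_vec n U y)"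
    and "U (adjoint_from_vec n U y) = y"
    using z by simp_all
qed

end

theory Submission
  imports Defs
begin

text \<open>The right singular vectors shared by \<open>R\<close> and \<open>J\<close> diagonalize \<open>R\<^sup>*R\<close> and \<open>J\<^sup>*J\<close>, hence also
  \<open>Q\<^sub>R = (I + \<rho> R\<^sup>*R)\<^sup>-\<^sup>1\<close> and \<open>Q\<^sub>J = (I + J\<^sup>*J / \<rho>)\<^sup>-\<^sup>1\<close>. With \<open>a = \<rho> r\<^sub>k\<^sup>2\<close> and \<open>b = d\<^sub>k\<^sup>2 / \<rho>\<close> the claims
  become \<open>1/(1+a) + 1/(1+b) \<ge> 1/(1+ab)\<close>, where \<open>ab = (d\<^sub>k r\<^sub>k)\<^sup>2\<close>, and
  \<open>1/((1+a)(1+b)) \<le> 1/(1+a+b)\<close>, where \<open>a + b = (d\<^sub>k\<^sup>2 + \<alpha> r\<^sub>k\<^sup>2)/\<rho> \<ge> \<mu>\<close>.\<close>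

lemma adjoint_from_vec_unit:
  assumes "unitary_from_vec n \<Phi>" "k < n"
  shows "adjoint_from_vec n \<Phi> (\<Phi> (unit_vec n k)) = unit_vec n k"
  using assms by (intro adjoint_from_vec_eqI) (auto simp: unitary_from_vec_def)

lemma inner_unitary_unit:
  assumes "unitary_from_vec n \<Phi>" "k < n"
  shows "v \<bullet> \<Phi> (unit_vec n k) = adjoint_from_vec n \<Phi> v $ k"
proof -
  have "\<Phi> (unit_vec n k) \<bullet> v = scalar_prod (unit_vec n k) (adjoint_from_vec n \<Phi> v)"
    by (rule unitary_adjoint_from_vec(2)[OF assms(1)]) simp
  then show ?thesis
    using unitary_adjoint_from_vec(1)[OF assms(1), of v] assms(2) by (simp add: inner_commute)
qed

text \<open>The products with \<open>\<Phi> (unit_vec n k)\<close> are the entries of the adjoint's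
  value, and \<open>\<Phi>\<close> recovers a vector from that value. Operators below are thus
  handled only through these coordinates.\<close>

lemma unitary_basis_eqI:
  assumes \<Phi>: "unitary_from_vec n \<Phi>"
    and eq: "\<And>k. k < n \<Longrightarrow> v \<bullet> \<Phi> (unit_vec n k) = w \<bullet> \<Phi> (unit_vec n k)"
  shows "v = w"
proof -
  let ?adj = "adjoint_from_vec n \<Phi>"
  have "?adj v = ?adj w"
  proof (rule eq_vecI)
    have dim: "dim_vec (?adj x) = n" for x
      using unitary_adjoint_from_vec(1)[OF \<Phi>] by (rule carrier_vecD)
    then show "dim_vec (?adj v) = dim_vec (?adj w)" by simp
    fix k assume "k < dim_vec (?adj w)"
    then have "k < n" by (simp add: dim)
    then show "?adj v $ k = ?adj w $ k"
      using eq[of k] inner_unitary_unit[OF \<Phi>] by simp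
  qed
  then have "\<Phi> (?adj v) = \<Phi> (?adj w)" by simp
  then show ?thesis by (simp only: unitary_adjoint_from_vec(3)[OF \<Phi>])
qed

lemma inner_unitary_unit_unit:
  assumes "unitary_from_vec n \<Phi>" "k < n" "l < n"
  shows "\<Phi> (unit_vec n l) \<bullet> \<Phi> (unit_vec n k) = (if l = k then 1 else 0)"
  using assms by (auto simp: inner_unitary_unit adjoint_from_vec_unit)

text \<open>An eigenvector has some nonzero coordinate, and comparing that coordinate forces the
  eigenvalue to be \<open>f k\<close>; conversely each basis vector is an eigenvector. The
  coordinatewise hypothesis passes directly to sums and compositions.\<close>

lemma eigenvalues_diagonal:
  assumes \<Phi>: "unitary_from_vec n \<Phi>"
    and F: "\<And>v k. k < n \<Longrightarrow> F v \<bullet> \<Phi> (unit_vec n k) = f k * (v \<bullet> \<Phi> (unit_vec n k))"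
  shows "eigenvalues F = f ` {..<n}"
proof (intro equalityI subsetI)
  fix c assume "c \<in> eigenvalues F"
  then obtain v where v: "v \<noteq> 0" "F v = c *\<^sub>R v" by (auto simp: eigenvalues_def)
  then obtain k where k: "k < n" "v \<bullet> \<Phi> (unit_vec n k) \<noteq> 0"
    using unitary_basis_eqI[OF \<Phi>, of v 0] by auto
  then show "c \<in> f ` {..<n}" using F[of k v] v by auto
next
  fix c assume "c \<in> f ` {..<n}"
  then obtain k where k: "k < n" "c = f k" by auto
  let ?v = "\<Phi> (unit_vec n k)"
  have "F ?v = c *\<^sub>R ?v"
    using k by (intro unitary_basis_eqI[OF \<Phi>]) (simp add: F inner_unitary_unit_unit[OF \<Phi>])
  moreover have "?v \<noteq> 0" using inner_unitary_unit_unit[OF \<Phi>, of k k] k by auto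
  ultimately show "c \<in> eigenvalues F" by (auto simp: eigenvalues_def)
qed

lemma rect_diag_mult_vec_index:
  assumes "x \<in> carrier_vec nc" "i < nr" "i < nc"
  shows "(rect_diag nr nc d *\<^sub>v x) $ i = d (Suc i) * x $ i"
proof -
  have "Matrix.row (rect_diag nr nc d) i = d (Suc i) \<cdot>\<^sub>v unit_vec nc i"
    using assms by (intro eq_vecI) (auto simp: rect_diag_def)
  then show ?thesis using assms by (simp add: rect_diag_def)
qed

lemma rect_diag_mult_unit_vec:
  assumes "k < nc"
  shows "rect_diag nr nc d *\<^sub>v unit_vec nc k =
    (if k < nr then d (Suc k) \<cdot>\<^sub>v unit_vec nr k else 0\<^sub>v nr)"
  using assms by (intro eq_vecI) (auto simp: rect_diag_def)

text \<open>Weak form of \<open>F\<^sup>*F \<phi> = d\<^sup>2 \<phi>\<close> for a right singular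
  vector, tested against \<open>v\<close>. If \<open>m \<le> k\<close>, column \<open>k\<close> of
  the rectangular diagonal matrix is zero, so \<open>d0\<close> is what makes the right side vanish
  as well.\<close>

lemma inner_singular_vector:
  assumes U: "unitary_from_vec m U" and \<Phi>: "unitary_from_vec n \<Phi>"
    and F: "\<And>q. F q = U (rect_diag m n d *\<^sub>v adjoint_from_vec n \<Phi> q)"
    and k: "k < n" and d0: "m \<le> k \<Longrightarrow> d (Suc k) = 0"
  shows "F v \<bullet> F (\<Phi> (unit_vec n k)) = (d (Suc k))\<^sup>2 * (v \<bullet> \<Phi> (unit_vec n k))"
proof -
  let ?x = "adjoint_from_vec n \<Phi> v" and ?D = "rect_diag m n d"
  have x: "?x \<in> carrier_vec n" by (rule unitary_adjoint_from_vec(1)[OF \<Phi>])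
  have D: "?D *\<^sub>v y \<in> carrier_vec m" for y
    by (rule carrier_vecI) (simp add: rect_diag_def)
  have "F v \<bullet> F (\<Phi> (unit_vec n k)) = scalar_prod (?D *\<^sub>v ?x) (?D *\<^sub>v unit_vec n k)"
    using U D by (simp add: F adjoint_from_vec_unit[OF \<Phi> k] unitary_from_vec_def)
  also have "\<dots> = (d (Suc k))\<^sup>2 * ?x $ k"
    using d0 D[of ?x] k x
    by (auto simp: rect_diag_mult_unit_vec rect_diag_mult_vec_index power2_eq_square)
  finally show ?thesis by (simp add: inner_unitary_unit[OF \<Phi> k])
qed

text \<open>Replaces the inverse and the adjoints by the normal equation in variational form. The
  inverse is genuine because \<open>c \<ge> 0\<close> and injectivity of \<open>X\<close> make the
  operator positive definite.\<close>

lemma damped_projector_inner: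
  fixes X :: "'a::euclidean_space \<Rightarrow> 'q::euclidean_space" and S :: "'a \<Rightarrow> 'z::euclidean_space"
  assumes X: "linear X" "inj X" and S: "linear S" and c: "0 \<le> c"
  obtains u where "damped_projector c X S v = X u"
    and "\<And>p. X u \<bullet> X p + c * (S u \<bullet> S p) = v \<bullet> X p"
proof -
  define G where "G = (\<lambda>v. c *\<^sub>R adjoint S (S v) + adjoint X (X v))"
  have G: "G u \<bullet> p = c * (S u \<bullet> S p) + X u \<bullet> X p" for u p
    by (simp add: G_def inner_add_left adjoint_clauses[OF S] adjoint_clauses[OF X(1)])
  have "linear G"
    unfolding G_def using X S
    by (intro linear_compose_add linear_compose_scale_right
        linear_compose[of S "adjoint S", unfolded o_def]
        linear_compose[of X "adjoint X", unfolded o_def] adjoint_linear)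
  moreover have "inj G"
  proof -
    have "u = 0" if "G u = 0" for u
    proof -
      have "0 = c * (S u \<bullet> S u) + X u \<bullet> X u" using G[of u u] that by simp
      moreover have "0 \<le> c * (S u \<bullet> S u)" using c by simp
      ultimately have "X u \<bullet> X u = 0" using inner_ge_zero[of "X u"] by linarith
      then show "u = 0" using X by (simp add: linear_injective_0)
    qed
    then show ?thesis by (simp add: linear_injective_0[OF \<open>linear G\<close>])
  qed
  ultimately have "surj G" by (intro linear_injective_imp_surjective) auto
  define u where "u = inv_into UNIV G (adjoint X v)"
  have "G u = adjoint X v" unfolding u_def by (rule surj_f_inv_f[OF \<open>surj G\<close>])
  then have "c * (S u \<bullet> S p) + X u \<bullet> X p = v \<bullet> X p" for p
    using G[of u p] by (simp add: adjoint_clauses[OF X(1)])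
  then have "X u \<bullet> X p + c * (S u \<bullet> S p) = v \<bullet> X p" for p by (simp add: add.commute)
  moreover have "damped_projector c X S v = X u"
    by (simp add: damped_projector_def u_def G_def)
  ultimately show thesis using that by blast
qed

theorem corollary5p3:
  fixes A :: "'u::euclidean_space \<Rightarrow> 'q::euclidean_space"
    and B :: "'u \<Rightarrow> 'y::euclidean_space"
    and R T :: "'q \<Rightarrow> 'q"
    and J :: "'q \<Rightarrow> 'y"
    and \<alpha> \<rho> \<mu> \<nu> \<delta> \<beta> :: real
    and d r :: "nat \<Rightarrow> real"
  assumes "DIM('u) = DIM('q)"
    and "linear A" and "bij A"
    and "linear B"
    and "linear R" and "bij R"
    and "T = (\<lambda>q. - q)"
    and "0 < \<alpha>" and "\<alpha> \<le> 1"
    and "\<rho> = sqrt \<alpha>"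
    and "J = (\<lambda>q. - B (inv_into UNIV A (T q)))"
    and "spectral_filtering R J d r"
    and "0 < \<mu>"
    and "\<forall>k\<in>{1..DIM('q)}. \<mu> \<le> (d k)\<^sup>2 + \<alpha> * (r k)\<^sup>2"
    and "\<forall>k\<in>{1..DIM('q)}. d k * r k \<le> \<nu>"
    and "\<delta> = 1/2 * inverse (1 + \<nu>\<^sup>2)"
    and "\<beta> = (1 + \<mu>) powr (-1/2)"
  shows "0 < \<delta> \<and> \<delta> \<le> 1/2 * lambda_min (\<lambda>q. Q_R \<alpha> \<rho> R T q + Q_J \<rho> A B q) \<and>
         sqrt (lambda_max (Q_R \<alpha> \<rho> R T \<circ> Q_J \<rho> A B)) \<le> \<beta> \<and> \<beta> < 1"
proof -
  let ?n = "DIM('q)"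
  have \<rho>: "0 < \<rho>" "\<rho> \<le> 1" "\<alpha> = \<rho>\<^sup>2"
    using assms(8-10) by auto
  \<comment> \<open>The sign in the definition of \<open>J\<close> cancels against
    \<open>T = -I\<close>.\<close>
  have J: "J q = B (inv_into UNIV A q)" for q
  proof -
    have "A (- inv_into UNIV A q) = - q"
      using \<open>bij A\<close> \<open>linear A\<close> by (simp add: linear_neg bij_is_surj surj_f_inv_f)
    then have "inv_into UNIV A (- q) = - inv_into UNIV A q"
      using \<open>bij A\<close> by (metis bij_is_inj inv_f_f)
    then show ?thesis using assms(7,11) \<open>linear B\<close> by (simp add: linear_neg)
  qed
  have JA: "J (A u) = B u" for u
    using \<open>bij A\<close> by (simp add: J bij_is_inj)
  obtain U V \<Phi> where U: "unitary_from_vec DIM('y) U" and V: "unitary_from_vec ?n V"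
    and \<Phi>: "unitary_from_vec ?n \<Phi>"
    and JU: "\<And>q. J q = U (rect_diag DIM('y) ?n d *\<^sub>v adjoint_from_vec ?n \<Phi> q)"
    and RV: "\<And>q. R q = V (rect_diag ?n ?n r *\<^sub>v adjoint_from_vec ?n \<Phi> q)"
    and dr0: "\<forall>k\<in>{1..?n}. 0 \<le> d k \<and> 0 \<le> r k"
    and d0: "\<forall>k\<in>{1..?n}. DIM('y) < k \<longrightarrow> d k = 0"
    using assms(12) unfolding spectral_filtering_def by metis
  define \<phi> where "\<phi> k = \<Phi> (unit_vec ?n k)" for k
  \<comment> \<open>\<open>a k\<close> and \<open>b k\<close> are the eigenvalues of
    \<open>\<rho> R\<^sup>*R\<close> and \<open>J\<^sup>*J / \<rho>\<close> at
    \<open>\<phi> k\<close>. Basis vectors count from 0, singular values from 1, hence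
    \<open>Suc\<close>.\<close>
  define a where "a k = \<rho> * (r (Suc k))\<^sup>2" for k
  define b where "b k = (d (Suc k))\<^sup>2 / \<rho>" for k
  have ab0: "0 \<le> a k" "0 \<le> b k" for k
    using \<rho> by (simp_all add: a_def b_def)
  have QR: "Q_R \<alpha> \<rho> R T v \<bullet> \<phi> k = inverse (1 + a k) * (v \<bullet> \<phi> k)" if k: "k < ?n" for v k
  proof -
    have T: "linear T" "inj T" unfolding assms(7) by (auto intro: linear_uminus inj_onI)
    obtain u where u: "damped_projector \<rho> T R v = T u"
      and eq: "\<And>p. T u \<bullet> T p + \<rho> * (R u \<bullet> R p) = v \<bullet> T p"
      using damped_projector_inner[OF T \<open>linear R\<close>, of \<rho> v] \<rho> by auto
    \<comment> \<open>The damping factor \<open>\<alpha> / \<rho>\<close> equals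
      \<open>\<rho>\<close>, because \<open>\<alpha>\<close> is the square of
      \<open>\<rho>\<close>.\<close>
    have Q: "Q_R \<alpha> \<rho> R T v = - u"
      using u \<rho> assms(7) by (simp add: Q_R_def power2_eq_square)
    have "R u \<bullet> R (\<phi> k) = (r (Suc k))\<^sup>2 * (u \<bullet> \<phi> k)"
      unfolding \<phi>_def by (rule inner_singular_vector[OF V \<Phi> RV k]) (use k in simp)
    then have *: "(1 + a k) * (- u \<bullet> \<phi> k) = v \<bullet> \<phi> k"
      using eq[of "\<phi> k"] by (simp add: assms(7) a_def algebra_simps)
    have "1 + a k \<noteq> 0" using ab0[of k] by auto
    then show ?thesis unfolding Q *[symmetric] by simp
  qed
  have QJ: "Q_J \<rho> A B v \<bullet> \<phi> k = inverse (1 + b k) * (v \<bullet> \<phi> k)" if k: "k < ?n" for v k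
  proof -
    have A: "inj A" using \<open>bij A\<close> by (rule bij_is_inj)
    obtain u where u: "damped_projector (1 / \<rho>) A B v = A u"
      and eq: "\<And>p. A u \<bullet> A p + 1 / \<rho> * (B u \<bullet> B p) = v \<bullet> A p"
      using damped_projector_inner[OF \<open>linear A\<close> A \<open>linear B\<close>, of "1 / \<rho>" v] \<rho> by auto
    \<comment> \<open>Testing with the preimage of \<open>\<phi> k\<close> under \<open>A\<close>
      turns \<open>B p\<close> into \<open>J (\<phi> k)\<close>, where the singular vectors of
      \<open>J\<close> apply.\<close>
    obtain p where p: "\<phi> k = A p" using \<open>bij A\<close> by (metis bij_pointE)
    have "J (A u) \<bullet> J (\<phi> k) = (d (Suc k))\<^sup>2 * (A u \<bullet> \<phi> k)"
      unfolding \<phi>_def by (rule inner_singular_vector[OF U \<Phi> JU k]) (use k d0 in simp)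
    then have "B u \<bullet> B p = (d (Suc k))\<^sup>2 * (A u \<bullet> \<phi> k)" by (simp add: p JA)
    then have *: "(1 + b k) * (A u \<bullet> \<phi> k) = v \<bullet> \<phi> k"
      using eq[of p] by (simp add: p b_def algebra_simps)
    have "1 + b k \<noteq> 0" using ab0[of k] by auto
    then show ?thesis unfolding Q_J_def u *[symmetric] by simp
  qed
  have ev_sum: "eigenvalues (\<lambda>q. Q_R \<alpha> \<rho> R T q + Q_J \<rho> A B q)
      = (\<lambda>k. inverse (1 + a k) + inverse (1 + b k)) ` {..<?n}"
    using QR QJ unfolding \<phi>_def
    by (intro eigenvalues_diagonal[OF \<Phi>]) (simp add: inner_add_left algebra_simps)
  \<comment> \<open>Both factors are diagonal in the same basis, so their eigenvalues
    multiply.\<close>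
  have ev_prod: "eigenvalues (Q_R \<alpha> \<rho> R T \<circ> Q_J \<rho> A B)
      = (\<lambda>k. inverse (1 + a k) * inverse (1 + b k)) ` {..<?n}"
    using QR QJ unfolding \<phi>_def by (intro eigenvalues_diagonal[OF \<Phi>]) simp
  have sum_ge: "inverse (1 + \<nu>\<^sup>2) \<le> inverse (1 + a k) + inverse (1 + b k)" if k: "k < ?n" for k
  proof -
    \<comment> \<open>The weights \<open>\<rho>\<close> and \<open>1 / \<rho>\<close> cancel here,
      so the bound is free of \<alpha>.\<close>
    have "a k * b k = (d (Suc k) * r (Suc k))\<^sup>2"
      using \<rho> by (simp add: a_def b_def power_mult_distrib)
    also have "\<dots> \<le> \<nu>\<^sup>2" using k dr0 assms(15) by (intro power_mono) auto
    finally have "inverse (1 + \<nu>\<^sup>2) \<le> inverse (1 + a k * b k)"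
      using ab0[of k] by (intro le_imp_inverse_le) (auto intro: add_pos_nonneg)
    also have "\<dots> \<le> (2 + a k + b k) / ((1 + a k) * (1 + b k))"
    proof -
      \<comment> \<open>After cross-multiplication, the right side exceeds the left by exactly 1
        plus this term.\<close>
      have "0 \<le> (1 + a k + b k) * (a k * b k)" using ab0[of k] by simp
      then have "(1 + a k) * (1 + b k) \<le> (2 + a k + b k) * (1 + a k * b k)"
        using ab0[of k] by (simp add: algebra_simps)
      moreover have "0 < 1 + a k * b k" using ab0[of k] by (simp add: add_pos_nonneg)
      moreover have "0 < (1 + a k) * (1 + b k)" using ab0[of k] by simp
      ultimately show ?thesis by (simp add: pos_le_divide_eq inverse_eq_divide pos_divide_le_eq)
    qed
    also have "\<dots> = inverse (1 + a k) + inverse (1 + b k)"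
    proof -
      have "1 + a k \<noteq> 0" "1 + b k \<noteq> 0" using ab0[of k] by auto
      then show ?thesis by (simp add: divide_simps)
    qed
    finally show ?thesis .
  qed
  have prod_le: "inverse (1 + a k) * inverse (1 + b k) \<le> inverse (1 + \<mu>)" if k: "k < ?n" for k
  proof -
    \<comment> \<open>Here \<alpha> \<le> 1 enters, through \<open>\<rho> \<le> 1\<close>: dividing
      the bound on \<open>(a k + b k) * \<rho>\<close> by \<open>\<rho>\<close> does not weaken
      it.\<close>
    have "\<mu> * \<rho> \<le> \<mu>" using \<rho> \<open>0 < \<mu>\<close> by (simp add: mult_left_le)
    also have "\<dots> \<le> (d (Suc k))\<^sup>2 + \<rho>\<^sup>2 * (r (Suc k))\<^sup>2" using k assms(14) \<rho> by simp
    also have "\<dots> = (a k + b k) * \<rho>" using \<rho> by (simp add: a_def b_def field_simps power2_eq_square)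
    finally have "\<mu> \<le> a k + b k" using \<rho> by simp
    also have "\<dots> \<le> a k + b k + a k * b k" using ab0[of k] by simp
    finally have "1 + \<mu> \<le> (1 + a k) * (1 + b k)" by (simp add: algebra_simps)
    then have "inverse ((1 + a k) * (1 + b k)) \<le> inverse (1 + \<mu>)"
      using \<open>0 < \<mu>\<close> by (intro le_imp_inverse_le) auto
    then show ?thesis by simp
  qed
  \<comment> \<open>Both spectra are finite images of this nonempty set, so \<open>Min\<close> and
    \<open>Max\<close> are attained and bounds on all elements carry over.\<close>
  have ne: "{..<?n} \<noteq> {}" by (auto simp: lessThan_empty_iff)
  have "0 < inverse (1 + \<nu>\<^sup>2)" by (intro positive_imp_inverse_positive add_pos_nonneg) auto
  then have "0 < \<delta>" using assms(16) by linarith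
  moreover have "inverse (1 + \<nu>\<^sup>2) \<le> lambda_min (\<lambda>q. Q_R \<alpha> \<rho> R T q + Q_J \<rho> A B q)"
    unfolding lambda_min_def ev_sum using ne sum_ge by (intro Min.boundedI) auto
  then have "\<delta> \<le> 1/2 * lambda_min (\<lambda>q. Q_R \<alpha> \<rho> R T q + Q_J \<rho> A B q)"
    using assms(16) by linarith
  moreover have \<beta>: "\<beta> = sqrt (inverse (1 + \<mu>))"
  proof -
    have "(1 + \<mu>) powr (- 1 / 2) = inverse ((1 + \<mu>) powr (1 / 2))"
      by (metis minus_divide_left powr_minus)
    then show ?thesis
      using \<open>0 < \<mu>\<close> by (simp add: assms(17) powr_half_sqrt real_sqrt_inverse)
  qed
  moreover have "lambda_max (Q_R \<alpha> \<rho> R T \<circ> Q_J \<rho> A B) \<le> inverse (1 + \<mu>)"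
    unfolding lambda_max_def ev_prod using ne prod_le by (intro Max.boundedI) auto
  then have "sqrt (lambda_max (Q_R \<alpha> \<rho> R T \<circ> Q_J \<rho> A B)) \<le> \<beta>"
    unfolding \<beta> by (rule real_sqrt_le_mono)
  moreover have "inverse (1 + \<mu>) < 1" using \<open>0 < \<mu>\<close> by (simp only: inverse_less_1_iff) auto
  then have "\<beta> < 1" unfolding \<beta> by (simp only: real_sqrt_lt_1_iff)
  ultimately show ?thesis by blast
qed

end
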